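(* There exist a $\mathcal{C}^\infty$ function $f : [-1,1]^2 \to \mathbb{R}$ with a unique critical point at the origin (i.e. the origin is the only point of $[-1,1]^2$ at which $\nabla f = 0$), and a constant $C < +\infty$, such that for every $x, y \in [-1,1]$, $$f(x,y) - \inf_{x' \in [-1,1]} f(x',y) \le C\, |\partial_x f(x,y)|^2 \quad\text{and}\quad \sup_{y' \in [-1,1]} f(x,y') - f(x,y) \le C\, |\partial_y f(x,y)|^2,$$ and yet, for every $z(0)$ in some non-empty open subset of $[-1,1]^2$, the gradient descent-ascent flow $(z(t))_{t \ge 0}$ of $f$ started from $z(0)$ is periodic.
   Context: The gradient descent-ascent (GDA) flow of a function $f(x,y)$, $(x,y) \in [-1,1]^2$, started from $z(0)$ is the solution $(z(t))_{t \ge 0}$, with values in $[-1,1]^2$, of the ordinary differential equation $$\partial_t z(t) = \begin{pmatrix} -\partial_x f \\ \partial_y f \end{pmatrix}(z(t)).$$ Derivatives at boundary points of the square are understood as one-sided. *)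

theory Defs
  imports "HOL-Analysis.Analysis"
begin

text \<open>Functions on the square are total functions \<open>real \<times> real \<Rightarrow> real\<close> of which only the values
  on \<open>square\<close> matter: every notion below is insensitive to the values elsewhere.\<close>

definition square :: "(real \<times> real) set" where
  "square = {-1..1} \<times> {-1..1}"

text \<open>Taking the derivative within \<open>{-1..1}\<close> makes it one-sided at \<open>-1\<close> and \<open>1\<close>. The operator
  \<open>vector_derivative\<close> is unspecified where no derivative exists, so existence is required
  separately in \<open>Ck_square\<close>.\<close>

definition partial_x :: "(real \<times> real \<Rightarrow> real) \<Rightarrow> real \<times> real \<Rightarrow> real" where
  "partial_x f p = vector_derivative (\<lambda>s. f (s, snd p)) (at (fst p) within {-1..1})"

definition partial_y :: "(real \<times> real \<Rightarrow> real) \<Rightarrow> real \<times> real \<Rightarrow> real" where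
  "partial_y f p = vector_derivative (\<lambda>s. f (fst p, s)) (at (snd p) within {-1..1})"

primrec Ck_square :: "nat \<Rightarrow> (real \<times> real \<Rightarrow> real) \<Rightarrow> bool" where
  "Ck_square 0 f \<longleftrightarrow> continuous_on square f"
| "Ck_square (Suc k) f \<longleftrightarrow>
     continuous_on square f \<and>
     (\<forall>x\<in>{-1..1}. \<forall>y\<in>{-1..1}.
        (\<lambda>s. f (s, y)) differentiable (at x within {-1..1}) \<and>
        (\<lambda>s. f (x, s)) differentiable (at y within {-1..1})) \<and>
     Ck_square k (partial_x f) \<and> Ck_square k (partial_y f)"

definition smooth_square :: "(real \<times> real \<Rightarrow> real) \<Rightarrow> bool" where
  "smooth_square f \<longleftrightarrow> (\<forall>k. Ck_square k f)"

definition critical_points :: "(real \<times> real \<Rightarrow> real) \<Rightarrow> (real \<times> real) set" where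
  "critical_points f = {p \<in> square. partial_x f p = 0 \<and> partial_y f p = 0}"

text \<open>Only the values of \<open>z\<close> at times \<open>t \<ge> 0\<close> are relevant.\<close>

definition GDA_flow ::
  "(real \<times> real \<Rightarrow> real) \<Rightarrow> real \<times> real \<Rightarrow> (real \<Rightarrow> real \<times> real) \<Rightarrow> bool" where
  "GDA_flow f z0 z \<longleftrightarrow>
     z 0 = z0 \<and>
     (\<forall>t\<ge>0. z t \<in> square \<and>
       (z has_vector_derivative (- partial_x f (z t), partial_y f (z t))) (at t within {0..}))"

definition periodic_flow :: "(real \<Rightarrow> real \<times> real) \<Rightarrow> bool" where
  "periodic_flow z \<longleftrightarrow> (\<exists>T>0. \<forall>t\<ge>0. z (t + T) = z t)"

end

theory Submission
  imports Defs
begin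

text \<open>
  The example is a small perturbation of the bilinear saddle \<open>x y\<close>, whose descent-ascent flow is the
  rigid rotation. The function is \<open>f = x y + e P\<close> with \<open>e > 0\<close> small and
  \<open>P = q (x\<^sup>2 - y\<^sup>2) - 16 x\<^sup>2 y\<^sup>2 (x\<^sup>2 - y\<^sup>2) B (x\<^sup>2 + y\<^sup>2)\<close>, where the smooth function \<open>B\<close> vanishes near \<open>0\<close>
  and equals \<open>1 / s\<^sup>2\<close> for \<open>s \<ge> 1/5\<close>. Outside a disc this is a homogeneous function of degree \<open>2\<close>, and \<open>B\<close>
  switches its correction term off near the origin because such a function is smooth at the origin only
  if it is a quadratic form.

  The Polyak-Lojasiewicz inequalities only see a neighbourhood of the axes. The correction to the
  quadratic form carries a factor \<open>y\<^sup>2\<close>, so for small \<open>\<bar>y\<bar>\<close> the function \<open>f (\<cdot>, y)\<close> is strongly convex with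
  modulus of order \<open>e\<close>. For all other \<open>y\<close> the term \<open>x y\<close> dominates, \<open>\<bar>\<partial>\<^sub>x f\<bar>\<close> is bounded below, and the
  inequality holds because \<open>f\<close> is bounded (\<open>saddle_PL_x\<close>). The same dichotomy confines critical
  points to a disc where \<open>B = 0\<close>, hence to the origin. The identity \<open>f (- y, x) = - f (x, y)\<close> turns each
  statement about \<open>x\<close> into the corresponding one about \<open>y\<close>.

  In polar coordinates, homogeneity gives the flow outside the disc the form
  \<open>r' = r R (\<theta>)\<close>, \<open>\<theta>' = \<Theta> (\<theta>)\<close> (\<open>saddle_polar\<close>), and every orbit that stays in this region closes up
  as soon as \<open>R / \<Theta>\<close> has integral \<open>0\<close> over one turn. Here \<open>R = - 2 e (q - h (\<theta>))\<close> is affine in \<open>q\<close> while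
  \<open>\<Theta>\<close> does not depend on \<open>q\<close>: a quadratic form \<open>x\<^sup>2 - y\<^sup>2\<close> causes damping, but contributes nothing to the
  rotation speed. So the balancing value of \<open>q\<close> is simply the mean of \<open>h\<close> (called \<open>swell\<close>) with weight
  \<open>1 / \<Theta>\<close> (\<open>ex_balanced_swell\<close>). It stays away from \<open>0\<close> as \<open>e\<close> tends to \<open>0\<close>, and this is what the
  inequalities require of \<open>q\<close>. The damping near the axes is compensated by
  expansion along the diagonals, where \<open>f\<close> need not be convex-concave.
\<close>


section \<open>Smooth functions of two real variables\<close>

text \<open>The index \<open>m\<close> makes the family closed under differentiation; \<open>flat 0\<close> is the standard smooth
  function that is positive exactly on the positive half-line.\<close>

definition flat :: "nat \<Rightarrow> real \<Rightarrow> real" where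
  "flat m t = (if t > 0 then exp (- 1 / t) / t ^ m else 0)"

lemma flat_pos: "t > 0 \<Longrightarrow> flat m t > 0"
  and flat_nonpos: "t \<le> 0 \<Longrightarrow> flat m t = 0"
  and flat_nonneg: "flat m t \<ge> 0"
  by (simp_all add: flat_def)

text \<open>Exponential decay beats every power: \<open>exp u = (exp (u / k)) ^ k \<ge> (u / k) ^ k\<close> with \<open>u = 1 / t\<close>
  and \<open>k = m + 2\<close>. The bound of second order at \<open>0\<close> yields differentiability there.\<close>

lemma flat_le_quadratic: "flat m t \<le> real (m + 2) ^ (m + 2) * t\<^sup>2"
proof (cases "t > 0")
  case True
  define k where "k = m + 2"
  have k: "real k > 0" by (simp add: k_def)
  have "(1 / (real k * t)) ^ k \<le> exp (1 / (real k * t)) ^ k"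
    using True k exp_ge_add_one_self[of "1 / (real k * t)"] by (intro power_mono) (linarith, simp)
  also have "\<dots> = exp (1 / t)"
    using k by (simp flip: exp_of_nat_mult)
  finally have "1 \<le> (real k * t) ^ k * exp (1 / t)"
    using True k by (simp add: power_one_over field_simps)
  then have "exp (- 1 / t) \<le> (real k * t) ^ k"
    by (simp add: exp_minus field_simps)
  also have "\<dots> = real k ^ k * t\<^sup>2 * t ^ m"
    by (simp add: k_def power_mult_distrib power_add power2_eq_square)
  finally show ?thesis
    using True by (simp add: flat_def k_def field_simps)
qed (simp add: flat_def)

lemma flat_has_derivative:
  "(flat m has_real_derivative flat (m + 2) t - real m * flat (m + 1) t) (at t)"
proof -
  consider "t > 0" | "t < 0" | "t = 0" by linarith
  then show ?thesis
  proof cases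
    case 1
    have "((\<lambda>t. exp (- 1 / t) / t ^ m) has_real_derivative
            flat (m + 2) t - real m * flat (m + 1) t) (at t)"
    proof (rule DERIV_cong)
      show "((\<lambda>t. exp (- 1 / t) / t ^ m) has_real_derivative
        (exp (- 1 / t) * (1 / t\<^sup>2) * t ^ m - exp (- 1 / t) * (real m * t ^ (m - 1))) / (t ^ m * t ^ m)) (at t)"
        using 1 by (auto intro!: derivative_eq_intros simp: power2_eq_square)
      show "(exp (- 1 / t) * (1 / t\<^sup>2) * t ^ m - exp (- 1 / t) * (real m * t ^ (m - 1))) / (t ^ m * t ^ m)
        = flat (m + 2) t - real m * flat (m + 1) t"
        using 1 by (cases m) (simp_all add: flat_def field_simps power2_eq_square)
    qed
    moreover have "\<forall>\<^sub>F s in nhds t. exp (- 1 / s) / s ^ m = flat m s"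
      using eventually_nhds_in_open[of "{0<..}" t] 1
      by (auto simp: flat_def elim!: eventually_mono)
    ultimately show ?thesis
      by (subst (asm) DERIV_cong_ev[OF refl _ refl]) auto
  next
    case 2
    have "((\<lambda>t. 0) has_real_derivative 0) (at t)" by simp
    moreover have "\<forall>\<^sub>F s in nhds t. 0 = flat m s"
      using eventually_nhds_in_open[of "{..<0}" t] 2
      by (auto simp: flat_def elim!: eventually_mono)
    ultimately have "(flat m has_real_derivative 0) (at t)"
      by (subst (asm) DERIV_cong_ev[OF refl _ refl]) auto
    then show ?thesis using 2 by (simp add: flat_def)
  next
    case 3
    have "((\<lambda>s. (flat m s - flat m 0) / (s - 0)) \<longlongrightarrow> 0) (at 0)"
    proof (rule Lim_null_comparison)
      show "\<forall>\<^sub>F s in at 0. norm ((flat m s - flat m 0) / (s - 0)) \<le> real (m + 2) ^ (m + 2) * \<bar>s\<bar>"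
        unfolding eventually_at
      proof (intro exI[of _ 1] conjI ballI impI)
        fix s :: real assume "s \<noteq> 0 \<and> dist s 0 < 1"
        then have s: "s \<noteq> 0" by simp
        have "flat m s / \<bar>s\<bar> \<le> real (m + 2) ^ (m + 2) * s\<^sup>2 / \<bar>s\<bar>"
          by (intro divide_right_mono flat_le_quadratic) auto
        also have "\<dots> = real (m + 2) ^ (m + 2) * \<bar>s\<bar>"
          using s by (cases "s > 0") (simp_all add: power2_eq_square)
        finally show "norm ((flat m s - flat m 0) / (s - 0)) \<le> real (m + 2) ^ (m + 2) * \<bar>s\<bar>"
          using s flat_nonneg[of m s] by (simp add: flat_nonpos)
      qed simp
      show "((\<lambda>s. real (m + 2) ^ (m + 2) * \<bar>s\<bar>) \<longlongrightarrow> 0) (at 0)"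
        by (auto intro!: tendsto_eq_intros)
    qed
    then show ?thesis
      using 3 by (simp add: has_field_derivative_iff flat_nonpos)
  qed
qed

text \<open>A class of functions on the whole plane, large enough for the construction, whose generators and
  operations are chosen such that partial derivatives stay in the class. Smoothness in the sense of
  \<open>smooth_square\<close> then follows by induction on the order.\<close>

inductive_set smooth_funs :: "(real \<times> real \<Rightarrow> real) set" where
  const: "(\<lambda>p. c) \<in> smooth_funs"
| coord_x: "fst \<in> smooth_funs"
| coord_y: "snd \<in> smooth_funs"
| add: "u \<in> smooth_funs \<Longrightarrow> v \<in> smooth_funs \<Longrightarrow> (\<lambda>p. u p + v p) \<in> smooth_funs"
| mult: "u \<in> smooth_funs \<Longrightarrow> v \<in> smooth_funs \<Longrightarrow> (\<lambda>p. u p * v p) \<in> smooth_funs"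
| inverse: "u \<in> smooth_funs \<Longrightarrow> (\<And>p. u p \<noteq> 0) \<Longrightarrow> (\<lambda>p. inverse (u p)) \<in> smooth_funs"
| flat: "u \<in> smooth_funs \<Longrightarrow> (\<lambda>p. flat m (u p)) \<in> smooth_funs"

lemma smooth_funs_diff:
  assumes "u \<in> smooth_funs" "v \<in> smooth_funs"
  shows "(\<lambda>p. u p - v p) \<in> smooth_funs"
  using smooth_funs.add[OF assms(1) smooth_funs.mult[OF smooth_funs.const[of "- 1"] assms(2)]]
  by simp

lemma smooth_funs_power: "u \<in> smooth_funs \<Longrightarrow> (\<lambda>p. u p ^ n) \<in> smooth_funs"
  by (induction n) (auto intro: smooth_funs.intros)

lemma smooth_funs_continuous: "u \<in> smooth_funs \<Longrightarrow> continuous_on A u"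
proof (induction rule: smooth_funs.induct)
  case (flat u m)
  have "continuous_on UNIV (flat m)"
    by (meson DERIV_isCont continuous_at_imp_continuous_on flat_has_derivative)
  then show ?case
    using flat continuous_on_compose2 by blast
qed (auto intro!: continuous_intros)

lemma smooth_funs_ex_partials:
  assumes "u \<in> smooth_funs"
  shows "\<exists>ux\<in>smooth_funs. \<exists>uy\<in>smooth_funs. \<forall>x y.
           ((\<lambda>s. u (s, y)) has_real_derivative ux (x, y)) (at x) \<and>
           ((\<lambda>s. u (x, s)) has_real_derivative uy (x, y)) (at y)"
  using assms
proof (induction rule: smooth_funs.induct)
  case (const c)
  show ?case
    by (rule bexI[of _ "\<lambda>p. 0"], rule bexI[of _ "\<lambda>p. 0"]) (auto intro: smooth_funs.const)
next
  case coord_x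
  show ?case
    by (rule bexI[of _ "\<lambda>p. 1"], rule bexI[of _ "\<lambda>p. 0"]) (auto intro: smooth_funs.const)
next
  case coord_y
  show ?case
    by (rule bexI[of _ "\<lambda>p. 0"], rule bexI[of _ "\<lambda>p. 1"]) (auto intro: smooth_funs.const)
next
  case (add u v)
  then obtain ux uy vx vy where "ux \<in> smooth_funs" "uy \<in> smooth_funs" "vx \<in> smooth_funs"
    "vy \<in> smooth_funs" and
    "\<And>x y. ((\<lambda>s. u (s, y)) has_real_derivative ux (x, y)) (at x)"
    "\<And>x y. ((\<lambda>s. u (x, s)) has_real_derivative uy (x, y)) (at y)"
    "\<And>x y. ((\<lambda>s. v (s, y)) has_real_derivative vx (x, y)) (at x)"
    "\<And>x y. ((\<lambda>s. v (x, s)) has_real_derivative vy (x, y)) (at y)"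
    by blast
  then show ?case
    by (intro bexI[of _ "\<lambda>p. ux p + vx p"] bexI[of _ "\<lambda>p. uy p + vy p"])
      (auto intro!: smooth_funs.add DERIV_add)
next
  case (mult u v)
  then obtain ux uy vx vy where "ux \<in> smooth_funs" "uy \<in> smooth_funs" "vx \<in> smooth_funs"
    "vy \<in> smooth_funs" and
    "\<And>x y. ((\<lambda>s. u (s, y)) has_real_derivative ux (x, y)) (at x)"
    "\<And>x y. ((\<lambda>s. u (x, s)) has_real_derivative uy (x, y)) (at y)"
    "\<And>x y. ((\<lambda>s. v (s, y)) has_real_derivative vx (x, y)) (at x)"
    "\<And>x y. ((\<lambda>s. v (x, s)) has_real_derivative vy (x, y)) (at y)"
    by blast
  with mult.hyps show ?case
    by (intro bexI[of _ "\<lambda>p. ux p * v p + vx p * u p"] bexI[of _ "\<lambda>p. uy p * v p + vy p * u p"])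
      (auto intro!: smooth_funs.intros DERIV_mult)
next
  case (inverse u)
  then obtain ux uy where "ux \<in> smooth_funs" "uy \<in> smooth_funs" and
    "\<And>x y. ((\<lambda>s. u (s, y)) has_real_derivative ux (x, y)) (at x)"
    "\<And>x y. ((\<lambda>s. u (x, s)) has_real_derivative uy (x, y)) (at y)"
    by blast
  note u = this
  have "(\<lambda>p. 0 - inverse (u p) * ux p * inverse (u p)) \<in> smooth_funs"
       "(\<lambda>p. 0 - inverse (u p) * uy p * inverse (u p)) \<in> smooth_funs"
    by (intro smooth_funs_diff smooth_funs.intros u inverse.hyps)+
  moreover have "((\<lambda>s. inverse (u (s, y))) has_real_derivative
      0 - inverse (u (x, y)) * ux (x, y) * inverse (u (x, y))) (at x)" for x y
    using DERIV_inverse'[OF u(3)[of y x] inverse.hyps(2)] by simp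
  moreover have "((\<lambda>s. inverse (u (x, s))) has_real_derivative
      0 - inverse (u (x, y)) * uy (x, y) * inverse (u (x, y))) (at y)" for x y
    using DERIV_inverse'[OF u(4)[of x y] inverse.hyps(2)] by simp
  ultimately show ?case
    by (intro bexI[of _ "\<lambda>p. 0 - inverse (u p) * ux p * inverse (u p)"]
              bexI[of _ "\<lambda>p. 0 - inverse (u p) * uy p * inverse (u p)"] allI conjI)
next
  case (flat u m)
  then obtain ux uy where "ux \<in> smooth_funs" "uy \<in> smooth_funs" and
    "\<And>x y. ((\<lambda>s. u (s, y)) has_real_derivative ux (x, y)) (at x)"
    "\<And>x y. ((\<lambda>s. u (x, s)) has_real_derivative uy (x, y)) (at y)"
    by blast
  note u = this
  let ?d = "\<lambda>p. flat (m + 2) (u p) - real m * flat (m + 1) (u p)"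
  have "(\<lambda>p. ?d p * ux p) \<in> smooth_funs" "(\<lambda>p. ?d p * uy p) \<in> smooth_funs"
    by (intro smooth_funs_diff smooth_funs.intros u flat.hyps)+
  moreover have "((\<lambda>s. flat m (u (s, y))) has_real_derivative ?d (x, y) * ux (x, y)) (at x)" for x y
    by (rule DERIV_chain2[OF flat_has_derivative u(3)])
  moreover have "((\<lambda>s. flat m (u (x, s))) has_real_derivative ?d (x, y) * uy (x, y)) (at y)" for x y
    by (rule DERIV_chain2[OF flat_has_derivative u(4)])
  ultimately show ?case
    by (intro bexI[of _ "\<lambda>p. ?d p * ux p"] bexI[of _ "\<lambda>p. ?d p * uy p"] allI conjI)
qed

definition dx :: "(real \<times> real \<Rightarrow> real) \<Rightarrow> real \<times> real \<Rightarrow> real" where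
  "dx u p = deriv (\<lambda>s. u (s, snd p)) (fst p)"

definition dy :: "(real \<times> real \<Rightarrow> real) \<Rightarrow> real \<times> real \<Rightarrow> real" where
  "dy u p = deriv (\<lambda>s. u (fst p, s)) (snd p)"

lemma
  assumes "u \<in> smooth_funs"
  shows dx_in_smooth_funs: "dx u \<in> smooth_funs" and dy_in_smooth_funs: "dy u \<in> smooth_funs"
    and DERIV_dx: "((\<lambda>s. u (s, y)) has_real_derivative dx u (x, y)) (at x)"
    and DERIV_dy: "((\<lambda>s. u (x, s)) has_real_derivative dy u (x, y)) (at y)"
proof -
  obtain ux uy where S: "ux \<in> smooth_funs" "uy \<in> smooth_funs" and D:
    "\<And>x y. ((\<lambda>s. u (s, y)) has_real_derivative ux (x, y)) (at x)"
    "\<And>x y. ((\<lambda>s. u (x, s)) has_real_derivative uy (x, y)) (at y)"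
    using smooth_funs_ex_partials[OF assms] by blast
  have "dx u = ux" "dy u = uy"
    using D[THEN DERIV_imp_deriv] by (auto simp: dx_def dy_def fun_eq_iff)
  with S D show "dx u \<in> smooth_funs" "dy u \<in> smooth_funs"
    "((\<lambda>s. u (s, y)) has_real_derivative dx u (x, y)) (at x)"
    "((\<lambda>s. u (x, s)) has_real_derivative dy u (x, y)) (at y)" by simp_all
qed

lemma partials_eq_on_square:
  assumes "u \<in> smooth_funs" "\<forall>p\<in>square. g p = u p" "x \<in> {-1..1}" "y \<in> {-1..1}"
  shows "((\<lambda>s. g (s, y)) has_real_derivative dx u (x, y)) (at x within {-1..1})"
    and "((\<lambda>s. g (x, s)) has_real_derivative dy u (x, y)) (at y within {-1..1})"
    and "partial_x g (x, y) = dx u (x, y)" and "partial_y g (x, y) = dy u (x, y)"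
proof -
  show X: "((\<lambda>s. g (s, y)) has_real_derivative dx u (x, y)) (at x within {-1..1})"
    by (rule has_field_derivative_transform_within[OF has_field_derivative_at_within[OF DERIV_dx[OF assms(1)]] zero_less_one])
      (use assms in \<open>auto simp: square_def\<close>)
  show Y: "((\<lambda>s. g (x, s)) has_real_derivative dy u (x, y)) (at y within {-1..1})"
    by (rule has_field_derivative_transform_within[OF has_field_derivative_at_within[OF DERIV_dy[OF assms(1)]] zero_less_one])
      (use assms in \<open>auto simp: square_def\<close>)
  show "partial_x g (x, y) = dx u (x, y)" "partial_y g (x, y) = dy u (x, y)"
    using X Y assms(3,4)
    by (auto simp: partial_x_def partial_y_def has_real_derivative_iff_has_vector_derivative
        intro!: vector_derivative_within_closed_interval)
qed

text \<open>The iterated partial derivatives on the square agree with those of \<open>u\<close> on the square only, since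
  \<open>vector_derivative\<close> is arbitrary outside. Hence the induction runs over functions \<open>g\<close> that agree with a
  member of the class there.\<close>

lemma smooth_funs_Ck_square:
  assumes "u \<in> smooth_funs" "\<forall>p\<in>square. g p = u p"
  shows "Ck_square k g"
  using assms
proof (induction k arbitrary: u g)
  case 0
  then show ?case
    using smooth_funs_continuous continuous_on_cong by (metis Ck_square.simps(1))
next
  case (Suc k)
  have c: "continuous_on square g"
    using smooth_funs_continuous[OF Suc.prems(1)] Suc.prems(2) by (metis continuous_on_cong)
  note P = partials_eq_on_square[OF Suc.prems]
  have d: "(\<lambda>s. g (s, y)) differentiable (at x within {-1..1}) \<and>
        (\<lambda>s. g (x, s)) differentiable (at y within {-1..1})"
    if "x \<in> {-1..1}" "y \<in> {-1..1}" for x y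
    using P(1,2)[OF that] real_differentiable_def by blast
  have "Ck_square k (partial_x g)"
    by (rule Suc.IH[OF dx_in_smooth_funs[OF Suc.prems(1)]]) (use P(3) in \<open>auto simp: square_def\<close>)
  moreover have "Ck_square k (partial_y g)"
    by (rule Suc.IH[OF dy_in_smooth_funs[OF Suc.prems(1)]]) (use P(4) in \<open>auto simp: square_def\<close>)
  ultimately show ?case using c d by simp
qed

lemma smooth_funs_smooth_square: "u \<in> smooth_funs \<Longrightarrow> smooth_square u"
  unfolding smooth_square_def using smooth_funs_Ck_square by blast

lemma smooth_funs_bounded:
  assumes "u \<in> smooth_funs"
  obtains M where "M \<ge> 1" "\<And>p. p \<in> square \<Longrightarrow> \<bar>u p\<bar> \<le> M"
proof -
  have "compact square" by (auto simp: square_def intro: compact_Times)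
  then have "bounded (u ` square)"
    using assms by (intro compact_imp_bounded compact_continuous_image smooth_funs_continuous)
  then obtain B where "\<And>p. p \<in> square \<Longrightarrow> norm (u p) \<le> B"
    unfolding bounded_iff by auto
  then show thesis by (intro that[of "max 1 B"]) force+
qed

lemma smooth_funs_Lipschitz:
  assumes "u \<in> smooth_funs"
  obtains L where "L \<ge> 1" "\<And>p p'. p \<in> square \<Longrightarrow> p' \<in> square \<Longrightarrow> \<bar>u p - u p'\<bar> \<le> L * dist p p'"
proof -
  obtain A where A: "A \<ge> 1" "\<And>p. p \<in> square \<Longrightarrow> \<bar>dx u p\<bar> \<le> A"
    using smooth_funs_bounded[OF dx_in_smooth_funs[OF assms]] by blast
  obtain B where B: "B \<ge> 1" "\<And>p. p \<in> square \<Longrightarrow> \<bar>dy u p\<bar> \<le> B"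
    using smooth_funs_bounded[OF dy_in_smooth_funs[OF assms]] by blast
  show thesis
  proof (rule that[of "A + B"])
    fix p p' :: "real \<times> real" assume pp: "p \<in> square" "p' \<in> square"
    obtain x y x' y' where p: "p = (x, y)" "p' = (x', y')" by (cases p, cases p') auto
    have I: "x \<in> {-1..1}" "y \<in> {-1..1}" "x' \<in> {-1..1}" "y' \<in> {-1..1}"
      using pp by (auto simp: p square_def)
    have "norm (u (x, y) - u (x', y)) \<le> A * norm (x - x')"
      using I A(2) by (intro field_differentiable_bound[of "{-1..1}" "\<lambda>s. u (s, y)" "\<lambda>s. dx u (s, y)"]
          has_field_derivative_at_within[OF DERIV_dx[OF assms]]) (auto simp: square_def)
    moreover have "norm (u (x', y) - u (x', y')) \<le> B * norm (y - y')"
      using I B(2) by (intro field_differentiable_bound[of "{-1..1}" "\<lambda>s. u (x', s)" "\<lambda>s. dy u (x', s)"]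
          has_field_derivative_at_within[OF DERIV_dy[OF assms]]) (auto simp: square_def)
    moreover have "norm (x - x') \<le> dist p p'" "norm (y - y') \<le> dist p p'"
      using dist_fst_le[of p p'] dist_snd_le[of p p'] by (auto simp: p dist_norm)
    ultimately show "\<bar>u p - u p'\<bar> \<le> (A + B) * dist p p'"
      using A(1) B(1) mult_left_mono[of "norm (x - x')" "dist p p'" A]
        mult_left_mono[of "norm (y - y')" "dist p p'" B]
      unfolding p distrib_right real_norm_def by linarith
  qed (use A B in simp)
qed

section \<open>A weakly damped rotation with a balancing term\<close>

text \<open>A single quotient interpolates smoothly between \<open>0\<close> on the half-line below \<open>1/10\<close> and
  \<open>1 / s\<^sup>2\<close> above \<open>1/5\<close>: one of the two \<open>flat\<close> terms in the denominator is always positive, and the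
  second one vanishes for \<open>s \<ge> 1/5\<close>.\<close>

definition cutoff :: "real \<Rightarrow> real" where
  "cutoff s = flat 0 (s - 1/10) * inverse (s\<^sup>2 * flat 0 (s - 1/10) + flat 0 (1/5 - s))"

lemma cutoff_denominator_pos: "s\<^sup>2 * flat 0 (s - 1/10) + flat 0 (1/5 - s) > 0"
proof (cases "s > 1/10")
  case True
  then show ?thesis by (intro add_pos_nonneg mult_pos_pos flat_pos flat_nonneg) auto
next
  case False
  then show ?thesis by (intro add_nonneg_pos mult_nonneg_nonneg flat_pos flat_nonneg) auto
qed

lemma cutoff_inner: "s \<le> 1/10 \<Longrightarrow> cutoff s = 0"
  by (simp add: cutoff_def flat_nonpos)

lemma cutoff_outer: "s \<ge> 1/5 \<Longrightarrow> cutoff s = 1 / s\<^sup>2"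
  using flat_pos[of "s - 1/10" 0] by (simp add: cutoff_def flat_nonpos field_simps)

text \<open>The factor \<open>y\<^sup>2\<close> of the correction term is kept apart in \<open>saddle\<close>, because it makes the effect of the
  correction on \<open>\<partial>\<^sub>x\<^sub>x\<close> of order \<open>y\<^sup>2\<close> near the horizontal axis.\<close>

definition ripple :: "real \<times> real \<Rightarrow> real" where
  "ripple p = fst p ^ 2 * (fst p ^ 2 - snd p ^ 2) * cutoff (fst p ^ 2 + snd p ^ 2)"

definition saddle :: "real \<Rightarrow> real \<Rightarrow> real \<times> real \<Rightarrow> real" where
  "saddle e q p = fst p * snd p + e * (q * (fst p ^ 2 - snd p ^ 2) - 16 * (snd p ^ 2 * ripple p))"

lemma ripple_in_smooth_funs: "ripple \<in> smooth_funs"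
proof -
  have s: "(\<lambda>p. fst p ^ 2 + snd p ^ 2) \<in> smooth_funs"
    by (intro smooth_funs.intros smooth_funs_power)
  have "(\<lambda>p. cutoff (fst p ^ 2 + snd p ^ 2)) \<in> smooth_funs"
    unfolding cutoff_def using cutoff_denominator_pos
    by (intro smooth_funs.mult smooth_funs.inverse smooth_funs.add smooth_funs_power
        smooth_funs.flat smooth_funs_diff smooth_funs.const s) (simp add: less_le)
  then show ?thesis
    unfolding ripple_def[abs_def]
    by (intro smooth_funs.mult smooth_funs_diff smooth_funs_power smooth_funs.coord_x
        smooth_funs.coord_y)
qed

lemma saddle_in_smooth_funs: "saddle e q \<in> smooth_funs"
  unfolding saddle_def[abs_def]
  by (intro smooth_funs.mult smooth_funs.add smooth_funs_diff smooth_funs_power smooth_funs.const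
      smooth_funs.coord_x smooth_funs.coord_y ripple_in_smooth_funs)

lemmas dx_ripple_in_smooth_funs = dx_in_smooth_funs[OF ripple_in_smooth_funs]
lemmas dxx_ripple_in_smooth_funs = dx_in_smooth_funs[OF dx_ripple_in_smooth_funs]

text \<open>This antisymmetry exchanges the roles of the two players: \<open>- f (x, \<cdot>)\<close> is \<open>f (\<cdot>, x)\<close> reflected.\<close>

lemma saddle_quarter_turn: "saddle e q (- y, x) = - saddle e q (x, y)"
  by (simp add: saddle_def ripple_def algebra_simps)

lemma dx_saddle: "dx (saddle e q) (x, y) = y + e * (2 * q * x - 16 * (y\<^sup>2 * dx ripple (x, y)))"
proof -
  have "((\<lambda>s. saddle e q (s, y)) has_real_derivative
      y + e * (2 * q * x - 16 * (y\<^sup>2 * dx ripple (x, y)))) (at x)"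
    unfolding saddle_def
    by (rule derivative_eq_intros DERIV_dx[OF ripple_in_smooth_funs] refl | simp)+
  then show ?thesis
    using DERIV_dx[OF saddle_in_smooth_funs] DERIV_unique by blast
qed

lemma DERIV_dx_saddle:
  "((\<lambda>s. dx (saddle e q) (s, y)) has_real_derivative
      e * (2 * q - 16 * (y\<^sup>2 * dx (dx ripple) (x, y)))) (at x)"
  unfolding dx_saddle
  by (rule derivative_eq_intros DERIV_dx[OF dx_ripple_in_smooth_funs] refl | simp)+

lemma dy_saddle: "dy (saddle e q) (x, y) = dx (saddle e q) (- y, x)"
proof -
  have "((\<lambda>s. - saddle e q (- s, x)) has_real_derivative dx (saddle e q) (- y, x)) (at y)"
    by (rule derivative_eq_intros refl DERIV_chain2[OF DERIV_dx[OF saddle_in_smooth_funs]] | simp)+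
  then have "((\<lambda>s. saddle e q (x, s)) has_real_derivative dx (saddle e q) (- y, x)) (at y)"
    by (simp add: saddle_quarter_turn)
  then show ?thesis
    using DERIV_dy[OF saddle_in_smooth_funs] DERIV_unique by blast
qed

lemma dx_ripple_inner:
  assumes "x\<^sup>2 + y\<^sup>2 < 1/10"
  shows "dx ripple (x, y) = 0"
proof -
  have "((\<lambda>s. ripple (s, y)) has_real_derivative 0) (at x)"
  proof (rule has_field_derivative_transform_within_open[where f = "\<lambda>s. 0" and S = "{s. s\<^sup>2 + y\<^sup>2 < 1/10}"])
    show "open {s. s\<^sup>2 + y\<^sup>2 < 1/10}"
      by (intro open_Collect_less continuous_intros)
  qed (use assms in \<open>auto simp: ripple_def cutoff_inner\<close>)
  then show ?thesis
    using DERIV_dx[OF ripple_in_smooth_funs] DERIV_unique by blast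
qed

lemma dx_ripple_outer:
  assumes "x\<^sup>2 + y\<^sup>2 > 1/5"
  shows "dx ripple (x, y) = 2 * x * y\<^sup>2 * (3 * x\<^sup>2 - y\<^sup>2) / (x\<^sup>2 + y\<^sup>2) ^ 3"
proof -
  define g where "g s = s\<^sup>2 * (s\<^sup>2 - y\<^sup>2) / (s\<^sup>2 + y\<^sup>2)\<^sup>2" for s :: real
  have nz: "x\<^sup>2 + y\<^sup>2 \<noteq> 0" using assms by linarith
  have "(g has_real_derivative
      ((2 * x * (x\<^sup>2 - y\<^sup>2) + 2 * x * x\<^sup>2) * (x\<^sup>2 + y\<^sup>2)\<^sup>2 - x\<^sup>2 * (x\<^sup>2 - y\<^sup>2) * (2 * (2 * x) * (x\<^sup>2 + y\<^sup>2)))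
        / ((x\<^sup>2 + y\<^sup>2)\<^sup>2 * (x\<^sup>2 + y\<^sup>2)\<^sup>2)) (at x)"
    unfolding g_def[abs_def] using nz by (auto intro!: derivative_eq_intros)
  also have "((2 * x * (x\<^sup>2 - y\<^sup>2) + 2 * x * x\<^sup>2) * (x\<^sup>2 + y\<^sup>2)\<^sup>2 - x\<^sup>2 * (x\<^sup>2 - y\<^sup>2) * (2 * (2 * x) * (x\<^sup>2 + y\<^sup>2)))
      = (2 * x * y\<^sup>2 * (3 * x\<^sup>2 - y\<^sup>2)) * (x\<^sup>2 + y\<^sup>2)"
    by algebra
  also have "(2 * x * y\<^sup>2 * (3 * x\<^sup>2 - y\<^sup>2)) * (x\<^sup>2 + y\<^sup>2) / ((x\<^sup>2 + y\<^sup>2)\<^sup>2 * (x\<^sup>2 + y\<^sup>2)\<^sup>2)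
      = 2 * x * y\<^sup>2 * (3 * x\<^sup>2 - y\<^sup>2) / (x\<^sup>2 + y\<^sup>2) ^ 3"
  proof -
    have "A * R / (R\<^sup>2 * R\<^sup>2) = A / R ^ 3" if "R \<noteq> 0" for A R :: real
      using that by (simp add: power2_eq_square power3_eq_cube)
    then show ?thesis using nz by blast
  qed
  finally have g: "(g has_real_derivative 2 * x * y\<^sup>2 * (3 * x\<^sup>2 - y\<^sup>2) / (x\<^sup>2 + y\<^sup>2) ^ 3) (at x)" .
  have "((\<lambda>s. ripple (s, y)) has_real_derivative 2 * x * y\<^sup>2 * (3 * x\<^sup>2 - y\<^sup>2) / (x\<^sup>2 + y\<^sup>2) ^ 3) (at x)"
  proof (rule has_field_derivative_transform_within_open[OF g, where S = "{s. s\<^sup>2 + y\<^sup>2 > 1/5}"])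
    show "open {s. s\<^sup>2 + y\<^sup>2 > 1/5}"
      by (intro open_Collect_less continuous_intros)
  qed (use assms in \<open>auto simp: ripple_def cutoff_outer g_def\<close>)
  then show ?thesis
    using DERIV_dx[OF ripple_in_smooth_funs] DERIV_unique by blast
qed

section \<open>The Polyak-Lojasiewicz inequalities\<close>

text \<open>By Taylor's formula \<open>g x' - g x \<ge> g' x d + m d\<^sup>2 / 2\<close> with \<open>d = x' - x\<close>; completing the square
  bounds the right-hand side from below by \<open>- (g' x)\<^sup>2 / (2 m)\<close>.\<close>

lemma strongly_convex_imp_PL:
  fixes g g' g'' :: "real \<Rightarrow> real"
  assumes "\<And>t. t \<in> {a..b} \<Longrightarrow> (g has_real_derivative g' t) (at t)"
    and "\<And>t. t \<in> {a..b} \<Longrightarrow> (g' has_real_derivative g'' t) (at t)"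
    and "\<And>t. t \<in> {a..b} \<Longrightarrow> g'' t \<ge> m" "m > 0" "x \<in> {a..b}" "x' \<in> {a..b}"
  shows "g x - g x' \<le> (g' x)\<^sup>2 / (2 * m)"
proof (cases "x = x'")
  case False
  define D where "D k = (if k = 0 then g else if k = 1 then g' else g'')" for k :: nat
  have "\<exists>t. (if x' < x then x' < t \<and> t < x else x < t \<and> t < x') \<and>
      g x' = (\<Sum>k<2. (D k x / fact k) * (x' - x) ^ k) + (D 2 t / fact 2) * (x' - x) ^ 2"
    using assms False by (intro Taylor[where a = a and b = b]) (auto simp: D_def less_2_cases_iff)
  then obtain t where "if x' < x then x' < t \<and> t < x else x < t \<and> t < x'"
    and t: "g x' = g x + g' x * (x' - x) + g'' t / 2 * (x' - x)\<^sup>2"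
    by (auto simp: D_def numeral_2_eq_2)
  then have t_in: "t \<in> {a..b}"
    using assms(5,6) by (auto split: if_splits)
  have "m / 2 * (x' - x)\<^sup>2 \<le> g'' t / 2 * (x' - x)\<^sup>2"
    using assms(3)[OF t_in] by (intro mult_right_mono) auto
  moreover have "0 \<le> (m * (x' - x) + g' x)\<^sup>2 / (2 * m)"
    using \<open>m > 0\<close> by simp
  moreover have "(m * (x' - x) + g' x)\<^sup>2 / (2 * m) =
      m / 2 * (x' - x)\<^sup>2 + g' x * (x' - x) + (g' x)\<^sup>2 / (2 * m)"
    using \<open>m > 0\<close> by (simp add: field_simps power2_eq_square)
  ultimately show ?thesis using t by linarith
qed (use assms in simp)

text \<open>The order of choice matters: \<open>M\<close> depends on \<open>ripple\<close> only, then \<open>e\<close> is fixed in terms of \<open>M\<close>, and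
  finally \<open>q\<close>, which depends on \<open>e\<close>, ranges over an interval known in advance. The threshold between
  the two regimes for \<open>y\<close> is \<open>1 / (16 M)\<close>.\<close>

locale twisted_saddle =
  fixes M e q :: real
  assumes M_ge: "M \<ge> 1"
    and dx_ripple_le: "p \<in> square \<Longrightarrow> \<bar>dx ripple p\<bar> \<le> M"
    and dxx_ripple_le: "p \<in> square \<Longrightarrow> \<bar>dx (dx ripple) p\<bar> \<le> M"
    and e_eq: "e = 1 / (1000 * M\<^sup>2)"
    and q_bounds: "1/4 \<le> q" "q \<le> 4"
begin

lemma e_pos: "e > 0" using M_ge by (simp add: e_eq)

lemma dx_saddle_near_y:
  assumes "x \<in> {-1..1}" "y \<in> {-1..1}"
  shows "\<bar>dx (saddle e q) (x, y) - y\<bar> \<le> 1 / (32 * M)"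
proof -
  have "y\<^sup>2 \<le> 1" using assms(2) by (auto simp: abs_square_le_1 abs_le_iff)
  moreover have W: "\<bar>dx ripple (x, y)\<bar> \<le> M"
    using assms by (intro dx_ripple_le) (auto simp: square_def)
  ultimately have 1: "\<bar>y\<^sup>2 * dx ripple (x, y)\<bar> \<le> 1 * M"
    unfolding abs_mult by (intro mult_mono) auto
  have 2: "\<bar>q * x\<bar> \<le> 4 * 1"
    unfolding abs_mult using assms q_bounds by (intro mult_mono) auto
  have "\<bar>2 * q * x - 16 * (y\<^sup>2 * dx ripple (x, y))\<bar> \<le> 24 * M"
    using 1 2 M_ge by (simp add: abs_le_iff)
  then have "\<bar>e * (2 * q * x - 16 * (y\<^sup>2 * dx ripple (x, y)))\<bar> \<le> e * (24 * M)"
    using e_pos by (simp add: abs_mult)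
  also have "\<dots> \<le> 1 / (32 * M)"
    using M_ge by (simp add: e_eq power2_eq_square field_simps)
  finally show ?thesis by (simp add: dx_saddle)
qed

lemma dxx_saddle_ge:
  assumes "x \<in> {-1..1}" "\<bar>y\<bar> \<le> 1 / (16 * M)"
  shows "e * (2 * q - 16 * (y\<^sup>2 * dx (dx ripple) (x, y))) \<ge> e / 4"
proof -
  have "1 / (16 * M) \<le> 1" using M_ge by simp
  then have "(x, y) \<in> square" using assms by (auto simp: square_def)
  then have "\<bar>dx (dx ripple) (x, y)\<bar> \<le> M" by (rule dxx_ripple_le)
  moreover have "y\<^sup>2 \<le> (1 / (16 * M))\<^sup>2"
    using assms(2) by (metis abs_ge_zero power2_abs power_mono)
  ultimately have "\<bar>y\<^sup>2 * dx (dx ripple) (x, y)\<bar> \<le> (1 / (16 * M))\<^sup>2 * M"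
    unfolding abs_mult by (intro mult_mono) auto
  also have "\<dots> \<le> 1 / 256"
    using M_ge by (simp add: power2_eq_square field_simps)
  finally have "1 / 4 \<le> 2 * q - 16 * (y\<^sup>2 * dx (dx ripple) (x, y))"
    using q_bounds by (simp add: abs_le_iff)
  then show ?thesis
    using e_pos mult_left_mono[of "1/4" _ e] by simp
qed

text \<open>Below the threshold for \<open>\<bar>y\<bar>\<close> strong convexity applies; above it the derivative is at least
  \<open>1 / (32 M)\<close> in absolute value, and the oscillation of the function is at most \<open>2 B\<close>.\<close>

lemma saddle_PL_x:
  obtains C where "\<And>x x' y. x \<in> {-1..1} \<Longrightarrow> x' \<in> {-1..1} \<Longrightarrow> y \<in> {-1..1} \<Longrightarrow>
    saddle e q (x, y) - saddle e q (x', y) \<le> C * (dx (saddle e q) (x, y))\<^sup>2"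
proof -
  obtain B where B: "B \<ge> 1" "\<And>p. p \<in> square \<Longrightarrow> \<bar>saddle e q p\<bar> \<le> B"
    using smooth_funs_bounded[OF saddle_in_smooth_funs] by blast
  define C where "C = 2 / e + 2 * B * (32 * M)\<^sup>2"
  have C: "2 / e \<le> C" "2 * B * (32 * M)\<^sup>2 \<le> C"
    using B(1) e_pos by (auto simp: C_def)
  show thesis
  proof (rule that[of C])
    fix x x' y :: real assume xy: "x \<in> {-1..1}" "x' \<in> {-1..1}" "y \<in> {-1..1}"
    let ?g = "dx (saddle e q) (x, y)"
    show "saddle e q (x, y) - saddle e q (x', y) \<le> C * ?g\<^sup>2"
    proof (cases "\<bar>y\<bar> \<le> 1 / (16 * M)")
      case True
      have "saddle e q (x, y) - saddle e q (x', y) \<le> ?g\<^sup>2 / (2 * (e / 4))"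
        using xy e_pos dxx_saddle_ge[OF _ True]
        by (intro strongly_convex_imp_PL[OF DERIV_dx[OF saddle_in_smooth_funs] DERIV_dx_saddle]) auto
      also have "\<dots> = 2 / e * ?g\<^sup>2" by simp
      also have "\<dots> \<le> C * ?g\<^sup>2" using C(1) by (intro mult_right_mono) auto
      finally show ?thesis .
    next
      case False
      have "1 / (16 * M) - 1 / (32 * M) = 1 / (32 * M)" using M_ge by (simp add: field_simps)
      with False have "1 / (32 * M) \<le> \<bar>?g\<bar>"
        using dx_saddle_near_y[OF xy(1,3)] by (simp add: abs_le_iff abs_if split: if_splits)
      then have "1 \<le> 32 * M * \<bar>?g\<bar>"
        using M_ge by (simp add: field_simps)
      then have "1 \<le> (32 * M * \<bar>?g\<bar>)\<^sup>2" by (simp add: one_le_power)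
      then have "2 * B * 1 \<le> 2 * B * (32 * M * \<bar>?g\<bar>)\<^sup>2"
        using B(1) by (intro mult_left_mono) auto
      also have "\<dots> = 2 * B * (32 * M)\<^sup>2 * ?g\<^sup>2" by (simp add: power_mult_distrib)
      also have "\<dots> \<le> C * ?g\<^sup>2" using C(2) by (intro mult_right_mono) auto
      finally show ?thesis
        using B(2)[of "(x, y)"] B(2)[of "(x', y)"] xy by (auto simp: square_def)
    qed
  qed
qed

text \<open>Where the gradient vanishes both coordinates are so small that the correction term is absent, and
  the gradient of the remaining quadratic form is an injective linear map.\<close>

lemma critical_point_unique:
  assumes "x \<in> {-1..1}" "y \<in> {-1..1}"
  shows "dx (saddle e q) (x, y) = 0 \<and> dy (saddle e q) (x, y) = 0 \<longleftrightarrow> x = 0 \<and> y = 0"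
proof -
  have near: "dx (saddle e q) (x, y) = y + 2 * e * q * x" if "x\<^sup>2 + y\<^sup>2 < 1/10" for x y
    using dx_ripple_inner[OF that] by (simp add: dx_saddle)
  show ?thesis
  proof
    assume 0: "dx (saddle e q) (x, y) = 0 \<and> dy (saddle e q) (x, y) = 0"
    have small: "t\<^sup>2 < 1 / 20" if "\<bar>t\<bar> \<le> 1 / (32 * M)" for t :: real
    proof -
      have "1 / (32 * M) \<le> 1 / 32" using M_ge by (simp add: field_simps)
      with that have "\<bar>t\<bar>\<^sup>2 \<le> (1 / 32)\<^sup>2" by (intro power_mono) auto
      then show ?thesis by (simp add: power2_eq_square)
    qed
    have "\<bar>y\<bar> \<le> 1 / (32 * M)" "\<bar>x\<bar> \<le> 1 / (32 * M)"
      using 0 dx_saddle_near_y[of x y] dx_saddle_near_y[of "- y" x] assms by (auto simp: dy_saddle)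
    then have xy: "x\<^sup>2 + y\<^sup>2 < 1/10" using small[of x] small[of y] by linarith
    then have y: "y = - (2 * e * q) * x" and x: "x = 2 * e * q * y"
      using 0 near[of x y] near[of "- y" x] by (auto simp: dy_saddle add.commute)
    have "x * x + y * y = x * (2 * e * q * y) + y * (- (2 * e * q) * x)" using x y by metis
    also have "\<dots> = 0" by (simp add: algebra_simps)
    finally show "x = 0 \<and> y = 0" using sum_squares_eq_zero_iff[of x y] by blast
  next
    assume "x = 0 \<and> y = 0"
    then show "dx (saddle e q) (x, y) = 0 \<and> dy (saddle e q) (x, y) = 0"
      by (simp add: dy_saddle near)
  qed
qed

end

section \<open>Angular motion and the balancing condition\<close>

lemma ex_antiderivative:
  fixes g :: "real \<Rightarrow> real"
  assumes "continuous_on UNIV g"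
  obtains G where "\<And>x. (G has_real_derivative g x) (at x)"
proof -
  have "\<exists>G. \<forall>x::real. -\<infinity> < ereal x \<longrightarrow> ereal x < \<infinity> \<longrightarrow> (G has_vector_derivative g x) (at x)"
    using assms by (intro einterval_antiderivative) (auto simp: continuous_on_eq_continuous_at)
  then show thesis
    using that by (auto simp: has_real_derivative_iff_has_vector_derivative)
qed

lemma DERIV_nonneg_imp_increment_nonneg:
  fixes G :: "real \<Rightarrow> real"
  assumes "\<And>x. (G has_real_derivative g x) (at x)" "\<And>x. g x \<ge> 0" "a \<le> b"
  shows "G a \<le> G b"
proof (rule DERIV_nonneg_imp_nondecreasing[OF assms(3)])
  show "\<exists>y. (G has_real_derivative y) (at x) \<and> y \<ge> 0" for x
    using assms(1)[of x] assms(2)[of x] by (intro exI[of _ "g x"] conjI)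
qed

lemma antiderivative_of_periodic:
  fixes G :: "real \<Rightarrow> real"
  assumes "\<And>x. (G has_real_derivative g x) (at x)" "\<And>x. g (x + P) = g x"
  shows "G (x + P) = G x + (G P - G 0)"
proof -
  have "((\<lambda>x. G (x + P) - G x) has_real_derivative 0) (at x)" for x
  proof -
    have "((\<lambda>x. G (x + P)) has_real_derivative g (x + P)) (at x)"
      using assms(1)[of "x + P"] by (simp add: DERIV_shift)
    from DERIV_diff[OF this assms(1)] show ?thesis by (simp add: assms(2))
  qed
  then have "G (x + P) - G x = G (0 + P) - G 0"
    using DERIV_isconst_all[of "\<lambda>x. G (x + P) - G x"] by blast
  then show ?thesis by simp
qed

text \<open>Shifting \<open>u\<close> by a multiple of the period moves it within one period of \<open>v\<close>, where the mean value
  inequality applies.\<close>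

lemma increment_of_periodic_le:
  fixes G :: "real \<Rightarrow> real"
  assumes G: "\<And>x. (G has_real_derivative g x) (at x)" and g: "\<And>x. \<bar>g x\<bar> \<le> m"
    and P: "P > 0" "\<And>x. G (x + P) = G x"
  shows "\<bar>G u - G v\<bar> \<le> m * P"
proof -
  have shift: "G (x + real n * P) = G x" for x n
    by (induction n) (use P(2)[of "x + real _ * P"] in \<open>auto simp: algebra_simps\<close>)
  have near: "\<bar>G u - G v\<bar> \<le> m * P" if "v \<le> u" for u v
  proof -
    define n where "n = nat \<lfloor>(u - v) / P\<rfloor>"
    have n: "real n = of_int \<lfloor>(u - v) / P\<rfloor>"
      using that P(1) by (simp add: n_def)
    have "real n \<le> (u - v) / P" "(u - v) / P < real n + 1"
      unfolding n by linarith+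
    then have w: "0 \<le> u - v - real n * P" "u - v - real n * P \<le> P"
      using P(1) by (simp_all add: field_simps)
    have "norm (G (u - real n * P) - G v) \<le> m * norm (u - real n * P - v)"
      using g by (intro field_differentiable_bound[of UNIV G g] has_field_derivative_at_within[OF G]) auto
    also have "\<dots> \<le> m * P"
      using w g[of 0] by (intro mult_left_mono) auto
    finally show ?thesis
      using shift[of "u - real n * P" n] by simp
  qed
  show ?thesis
    using near[of u v] near[of v u] by (cases "v \<le> u") (auto simp: abs_minus_commute)
qed

text \<open>The autonomous equation \<open>\<tau>' = \<Theta> (\<tau>)\<close> on the line is solved by inverting the time function \<open>F\<close>,
  an antiderivative of \<open>1 / \<Theta>\<close>; the increment \<open>T\<close> of \<open>F\<close> over a period of \<open>\<Theta>\<close> is the time of one turn.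
  The bound on \<open>\<Theta>\<close> prevents \<open>F\<close> from converging, so that the solution exists for all times.\<close>

lemma ex_periodic_rotation:
  fixes F \<Theta> :: "real \<Rightarrow> real"
  assumes F: "\<And>x. (F has_real_derivative 1 / \<Theta> x) (at x)"
    and \<Theta>: "\<And>x. 0 < \<Theta> x" "\<And>x. \<Theta> x \<le> 2"
    and per: "\<And>x. F (x + P) = F x + T"
  obtains \<tau> where "\<tau> 0 = start" "\<And>t. (\<tau> has_real_derivative \<Theta> (\<tau> t)) (at t)"
    "\<And>t. \<tau> (t + T) = \<tau> t + P"
proof -
  have speed: "F b - F a \<ge> (b - a) / 2" if "a \<le> b" for a b
  proof -
    have "((\<lambda>x. F x - x / 2) has_real_derivative 1 / \<Theta> x - 1 / 2) (at x)" for x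
      by (intro DERIV_diff F DERIV_cdivide DERIV_ident)
    moreover have "0 \<le> 1 / \<Theta> x - 1 / 2" for x
      using \<Theta>[of x] by (simp add: field_simps)
    ultimately have "F a - a / 2 \<le> F b - b / 2"
      using that by (rule DERIV_nonneg_imp_increment_nonneg)
    then show ?thesis by (simp add: field_simps)
  qed
  have inj: "inj F"
  proof (rule injI)
    fix a b assume eq: "F a = F b"
    show "a = b"
    proof (cases a b rule: linorder_cases)
      case less
      then have "(b - a) / 2 \<le> F b - F a" by (intro speed) (rule less_imp_le)
      also have "F b - F a = 0" unfolding eq by (rule diff_self)
      finally show ?thesis using less by simp
    next
      case greater
      then have "(a - b) / 2 \<le> F a - F b" by (intro speed) (rule less_imp_le)
      also have "F a - F b = 0" unfolding eq by (rule diff_self)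
      finally show ?thesis using greater by simp
    qed
  qed
  have cont: "isCont F x" for x using F DERIV_isCont by blast
  have hit: "\<exists>x. F x = y" for y
  proof -
    define R where "R = 2 * \<bar>y - F 0\<bar>"
    have R: "0 \<le> R" by (simp add: R_def)
    have "F 0 - F (- R) \<ge> R / 2" "F R - F 0 \<ge> R / 2"
      using speed[of "- R" 0] speed[of 0 R] R by simp_all
    moreover have "R / 2 = \<bar>y - F 0\<bar>" by (simp add: R_def)
    ultimately have "F (- R) \<le> y" "y \<le> F R" by linarith+
    moreover have "- R \<le> R" using R by linarith
    ultimately show ?thesis
      using IVT[of F "- R" y R] cont by blast
  qed
  have surj: "F (inv F y) = y" for y
    by (rule f_inv_into_f) (use hit[of y] in blast)
  have left: "inv F (F x) = x" for x by (rule inv_f_f[OF inj])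
  have DG: "(inv F has_real_derivative \<Theta> (inv F y)) (at y)" for y
  proof -
    have "isCont (inv F) (F (inv F y))"
      by (rule isCont_inverse_function[where d = 1]) (simp_all add: left cont)
    then have "isCont (inv F) y" by (simp add: surj)
    then have "(inv F has_real_derivative inverse (1 / \<Theta> (inv F y))) (at y)"
      using \<Theta>(1)[of "inv F y"]
      by (intro DERIV_inverse_function[where a = "y - 1" and b = "y + 1" and f = F] F surj) simp_all
    then show ?thesis by simp
  qed
  show thesis
  proof (rule that[of "\<lambda>t. inv F (t + F start)"])
    show "inv F (0 + F start) = start" by (simp add: left)
    show "((\<lambda>t. inv F (t + F start)) has_real_derivative \<Theta> (inv F (t + F start))) (at t)" for t
      using DG[of "t + F start"] DERIV_shift[of "inv F" _ t "F start"] by blast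
    fix t
    have "F (inv F (t + F start) + P) = t + T + F start" by (simp add: per surj)
    with left[of "inv F (t + F start) + P"]
    show "inv F (t + T + F start) = inv F (t + F start) + P" by (simp only:)
  qed
qed

text \<open>For a point \<open>(r cos \<theta>, r sin \<theta>)\<close> in the region of homogeneity, \<open>turn_rate e \<theta>\<close> is the angular velocity
  of the flow and \<open>- 2 e (q - swell \<theta>)\<close> the logarithmic growth rate of the radius; see \<open>saddle_polar\<close>.\<close>

definition turn_rate :: "real \<Rightarrow> real \<Rightarrow> real" where
  "turn_rate e \<theta> = 1 - 32 * e * (cos \<theta> * sin \<theta> * ((cos \<theta>)\<^sup>2 - (sin \<theta>)\<^sup>2) ^ 3)"

definition swell :: "real \<Rightarrow> real" where
  "swell \<theta> = 16 * (cos \<theta> * sin \<theta>)\<^sup>2 * (6 * (cos \<theta> * sin \<theta>)\<^sup>2 - cos \<theta> ^ 4 - sin \<theta> ^ 4)"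

lemma turn_rate_bounds:
  assumes "0 < e" "e \<le> 1 / 1000"
  shows "3/4 \<le> turn_rate e \<theta>" "turn_rate e \<theta> \<le> 5/4"
proof -
  have "turn_rate e \<theta> = 1 - 16 * e * (sin (2 * \<theta>) * cos (2 * \<theta>) ^ 3)"
    by (simp add: turn_rate_def sin_double cos_double)
  moreover have "\<bar>sin (2 * \<theta>) * cos (2 * \<theta>) ^ 3\<bar> \<le> 1"
    unfolding abs_mult power_abs by (intro mult_le_one power_le_one) auto
  then have "\<bar>16 * e * (sin (2 * \<theta>) * cos (2 * \<theta>) ^ 3)\<bar> \<le> 16 * e * 1"
    using assms unfolding abs_mult[of "16 * e"] by (intro mult_mono) auto
  ultimately show "3/4 \<le> turn_rate e \<theta>" "turn_rate e \<theta> \<le> 5/4"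
    using assms unfolding abs_le_iff by linarith+
qed

lemma swell_eq: "swell \<theta> = 8 * ((sin (2 * \<theta>))\<^sup>2)\<^sup>2 - 4 * (sin (2 * \<theta>))\<^sup>2"
proof -
  have "cos \<theta> ^ 4 + sin \<theta> ^ 4 = ((cos \<theta>)\<^sup>2 + (sin \<theta>)\<^sup>2)\<^sup>2 - 2 * (cos \<theta> * sin \<theta>)\<^sup>2"
    by algebra
  then have "swell \<theta> = 16 * (cos \<theta> * sin \<theta>)\<^sup>2 * (8 * (cos \<theta> * sin \<theta>)\<^sup>2 - 1)"
    by (simp add: swell_def)
  also have "\<dots> = 8 * ((2 * sin \<theta> * cos \<theta>)\<^sup>2)\<^sup>2 - 4 * (2 * sin \<theta> * cos \<theta>)\<^sup>2"
    by algebra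
  finally show ?thesis by (simp add: sin_double)
qed

lemma swell_bounds: "- (1/2) \<le> swell \<theta>" "swell \<theta> \<le> 4"
proof -
  define w where "w = (sin (2 * \<theta>))\<^sup>2"
  have w: "0 \<le> w" "w \<le> 1" by (auto simp: w_def abs_square_le_1)
  have s: "swell \<theta> = 8 * w\<^sup>2 - 4 * w" by (simp add: swell_eq w_def)
  have "0 \<le> 8 * (w - 1/4)\<^sup>2" by simp
  then show "- (1/2) \<le> swell \<theta>" unfolding s by (simp add: power2_eq_square algebra_simps)
  have "w\<^sup>2 \<le> w" using w by (simp add: power2_eq_square mult_left_le)
  then show "swell \<theta> \<le> 4" unfolding s using w by linarith
qed

text \<open>In Fourier form \<open>swell \<theta> = 1 - 2 cos (4 \<theta>) + cos (8 \<theta>)\<close>, so \<open>swell\<close> has mean \<open>1\<close>. This is what makes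
  the balancing coefficient positive.\<close>

lemma DERIV_antiderivative_swell:
  "((\<lambda>\<theta>. \<theta> - sin (4 * \<theta>) / 2 + sin (8 * \<theta>) / 8) has_real_derivative swell \<theta>) (at \<theta>)"
proof -
  have c4: "cos (4 * \<theta>) = 1 - 2 * (sin (2 * \<theta>))\<^sup>2"
    using cos_double_sin[of "2 * \<theta>"] by simp
  have c8: "cos (8 * \<theta>) = 2 * (cos (4 * \<theta>))\<^sup>2 - 1"
    using cos_double_cos[of "4 * \<theta>"] by simp
  have "swell \<theta> = 1 - 2 * cos (4 * \<theta>) + cos (8 * \<theta>)"
    unfolding c8 c4 swell_eq by algebra
  then show ?thesis
    by (auto intro!: derivative_eq_intros)
qed

text \<open>The function \<open>\<sigma>\<close> is the logarithm of the radius along an orbit, as a function of the angle. It equals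
  \<open>- 2 e (q F - A)\<close> for antiderivatives \<open>F\<close> of \<open>1 / \<Theta>\<close> and \<open>A\<close> of \<open>swell / \<Theta>\<close>, so it is periodic exactly if
  \<open>q\<close> is the ratio of the increments of \<open>A\<close> and \<open>F\<close> over one turn. The bounds on \<open>q\<close> come from those on
  \<open>swell\<close> and its mean together with \<open>3/4 \<le> \<Theta> \<le> 5/4\<close>.\<close>

lemma ex_balanced_swell:
  assumes e: "0 < e" "e \<le> 1 / 1000"
  obtains q F \<sigma> T where "1/4 \<le> q" "q \<le> 4" "T > 0"
    "\<And>\<theta>. (F has_real_derivative 1 / turn_rate e \<theta>) (at \<theta>)"
    "\<And>\<theta>. F (\<theta> + 2 * pi) = F \<theta> + T"
    "\<And>\<theta>. (\<sigma> has_real_derivative - 2 * e * (q - swell \<theta>) / turn_rate e \<theta>) (at \<theta>)"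
    "\<And>\<theta>. \<sigma> (\<theta> + 2 * pi) = \<sigma> \<theta>"
proof -
  note \<Theta> = turn_rate_bounds[OF e]
  have nz: "turn_rate e \<theta> \<noteq> 0" for \<theta> using \<Theta>(1)[of \<theta>] by auto
  have pos: "turn_rate e \<theta> > 0" for \<theta> using \<Theta>(1)[of \<theta>] by auto
  have c: "continuous_on UNIV (turn_rate e)" "continuous_on UNIV swell"
    unfolding turn_rate_def[abs_def] swell_def[abs_def] by (intro continuous_intros)+
  obtain F where F: "\<And>\<theta>. (F has_real_derivative 1 / turn_rate e \<theta>) (at \<theta>)"
    by (rule ex_antiderivative[of "\<lambda>\<theta>. 1 / turn_rate e \<theta>"]) (use c nz in \<open>auto intro!: continuous_intros\<close>)
  obtain A where A: "\<And>\<theta>. (A has_real_derivative swell \<theta> / turn_rate e \<theta>) (at \<theta>)"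
    by (rule ex_antiderivative[of "\<lambda>\<theta>. swell \<theta> / turn_rate e \<theta>"]) (use c nz in \<open>auto intro!: continuous_intros\<close>)
  have per: "turn_rate e (\<theta> + 2 * pi) = turn_rate e \<theta>" "swell (\<theta> + 2 * pi) = swell \<theta>" for \<theta>
    by (simp_all add: turn_rate_def swell_def)
  define T where "T = F (2 * pi) - F 0"
  define S where "S = A (2 * pi) - A 0"
  define q where "q = S / T"
  have F_per: "F (\<theta> + 2 * pi) = F \<theta> + T" for \<theta>
    unfolding T_def by (rule antiderivative_of_periodic[OF F]) (simp add: per)
  have A_per: "A (\<theta> + 2 * pi) = A \<theta> + S" for \<theta>
    unfolding S_def by (rule antiderivative_of_periodic[OF A]) (simp add: per)
  have T_ge: "8/5 * pi \<le> T"
  proof -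
    have "((\<lambda>x. F x - 4/5 * x) has_real_derivative 1 / turn_rate e x - 4/5) (at x)" for x
      by (rule derivative_eq_intros F refl | simp)+
    moreover have "0 \<le> 1 / turn_rate e x - 4/5" for x using \<Theta>(2)[of x] pos[of x] by (simp add: field_simps)
    ultimately have "F 0 - 4/5 * 0 \<le> F (2 * pi) - 4/5 * (2 * pi)"
      by (rule DERIV_nonneg_imp_increment_nonneg) simp
    then show ?thesis by (simp add: T_def)
  qed
  have T_le: "T \<le> 8/3 * pi"
  proof -
    have "((\<lambda>x. 4/3 * x - F x) has_real_derivative 4/3 - 1 / turn_rate e x) (at x)" for x
      by (rule derivative_eq_intros F refl | simp)+
    moreover have "0 \<le> 4/3 - 1 / turn_rate e x" for x using \<Theta>(1)[of x] pos[of x] by (simp add: field_simps)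
    ultimately have "4/3 * 0 - F 0 \<le> 4/3 * (2 * pi) - F (2 * pi)"
      by (rule DERIV_nonneg_imp_increment_nonneg) simp
    then show ?thesis by (simp add: T_def)
  qed
  have T_pos: "T > 0" using T_ge pi_gt_zero by linarith
  have S_le: "S \<le> 4 * T"
  proof -
    have "((\<lambda>x. 4 * F x - A x) has_real_derivative (4 - swell x) / turn_rate e x) (at x)" for x
      by (rule derivative_eq_intros F A refl | simp add: diff_divide_distrib)+
    moreover have "0 \<le> (4 - swell x) / turn_rate e x" for x
      using swell_bounds(2)[of x] pos[of x] by (simp add: field_simps)
    ultimately have "4 * F 0 - A 0 \<le> 4 * F (2 * pi) - A (2 * pi)"
      by (rule DERIV_nonneg_imp_increment_nonneg) simp
    then show ?thesis by (simp add: S_def T_def algebra_simps)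
  qed
  \<comment> \<open>adding \<open>1/2\<close> makes \<open>swell\<close> nonnegative, so that \<open>1 / \<Theta> \<ge> 4/5\<close> may be used under the integral\<close>
  have S_ge: "12/5 * pi \<le> S + T / 2"
  proof -
    let ?H = "\<lambda>x. A x + F x / 2 - 4/5 * ((x - sin (4 * x) / 2 + sin (8 * x) / 8) + x / 2)"
    have "(?H has_real_derivative (swell x + 1/2) * (1 / turn_rate e x - 4/5)) (at x)" for x
    proof (rule DERIV_cong)
      show "(?H has_real_derivative swell x / turn_rate e x + (1 / turn_rate e x) / 2
          - 4/5 * (swell x + 1/2)) (at x)"
        by (intro DERIV_diff DERIV_add A F DERIV_cdivide DERIV_cmult DERIV_antiderivative_swell DERIV_ident)
    qed (simp add: algebra_simps add_divide_distrib)
    moreover have "0 \<le> (swell x + 1/2) * (1 / turn_rate e x - 4/5)" for x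
      using swell_bounds(1)[of x] \<Theta>(2)[of x] pos[of x] by (intro mult_nonneg_nonneg) (auto simp: field_simps)
    ultimately have "?H 0 \<le> ?H (2 * pi)"
      by (rule DERIV_nonneg_imp_increment_nonneg) simp
    moreover have "sin (4 * (2 * pi)) = 0" "sin (8 * (2 * pi)) = 0"
      using sin_npi[of 8] sin_npi[of 16] by (simp_all add: mult.commute)
    ultimately show ?thesis by (simp add: S_def T_def field_simps)
  qed
  have "T / 4 \<le> S" using S_ge T_le pi_gt_zero by linarith
  then have q: "1/4 \<le> q" "q \<le> 4"
    using S_le T_pos by (simp_all add: q_def field_simps)
  define \<sigma> where "\<sigma> \<theta> = - 2 * e * (q * F \<theta> - A \<theta>)" for \<theta>
  have "(\<sigma> has_real_derivative - 2 * e * (q - swell \<theta>) / turn_rate e \<theta>) (at \<theta>)" for \<theta>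
    unfolding \<sigma>_def
    by (rule DERIV_cong[OF DERIV_cmult[OF DERIV_diff[OF DERIV_cmult[OF F] A]]])
      (simp flip: diff_divide_distrib)
  moreover have "\<sigma> (\<theta> + 2 * pi) = \<sigma> \<theta>" for \<theta>
  proof -
    have "q * T = S" using T_pos by (simp add: q_def)
    then show ?thesis by (simp add: \<sigma>_def F_per A_per distrib_left)
  qed
  ultimately show thesis
    using that q T_pos F F_per by blast
qed

section \<open>Uniqueness of the flow\<close>

lemma GDA_flow_iff:
  assumes "u \<in> smooth_funs"
  shows "GDA_flow u z0 z \<longleftrightarrow> z 0 = z0 \<and> (\<forall>t\<ge>0. z t \<in> square \<and>
    (z has_vector_derivative (- dx u (z t), dy u (z t))) (at t within {0..}))"
proof -
  have "partial_x u p = dx u p \<and> partial_y u p = dy u p" if "p \<in> square" for p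
    using partials_eq_on_square(3,4)[OF assms, of u "fst p" "snd p"] that by (auto simp: square_def)
  then show ?thesis unfolding GDA_flow_def by metis
qed

text \<open>Gronwall's argument: if \<open>K\<close> is a Lipschitz constant of the vector field on the square, then
  \<open>exp (- 2 K t)\<close> times the squared distance of the two solutions is nonincreasing, and it starts at \<open>0\<close>.\<close>

lemma GDA_flow_unique:
  assumes u: "u \<in> smooth_funs" and "GDA_flow u z0 z" "GDA_flow u z0 w" "t \<ge> 0"
  shows "z t = w t"
proof -
  obtain A where A: "A \<ge> 1" "\<And>p p'. p \<in> square \<Longrightarrow> p' \<in> square \<Longrightarrow> \<bar>dx u p - dx u p'\<bar> \<le> A * dist p p'"
    using smooth_funs_Lipschitz[OF dx_in_smooth_funs[OF u]] by blast
  obtain B where B: "B \<ge> 1" "\<And>p p'. p \<in> square \<Longrightarrow> p' \<in> square \<Longrightarrow> \<bar>dy u p - dy u p'\<bar> \<le> B * dist p p'"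
    using smooth_funs_Lipschitz[OF dy_in_smooth_funs[OF u]] by blast
  define V where "V p = (- dx u p, dy u p)" for p
  define K where "K = A + B"
  have V: "norm (V p - V p') \<le> K * norm (p - p')" if "p \<in> square" "p' \<in> square" for p p'
  proof -
    have "norm (V p - V p') \<le> norm (- (dx u p - dx u p')) + norm (dy u p - dy u p')"
      using norm_Pair_le[of "- (dx u p - dx u p')" "dy u p - dy u p'"] by (simp add: V_def)
    also have "\<dots> \<le> A * dist p p' + B * dist p p'"
      using A(2)[OF that] B(2)[OF that] by (intro add_mono) simp_all
    finally show ?thesis by (simp add: K_def dist_norm algebra_simps)
  qed
  have z: "z 0 = z0" "\<And>s. s \<ge> 0 \<Longrightarrow> z s \<in> square"
      "\<And>s. s \<ge> 0 \<Longrightarrow> (z has_vector_derivative V (z s)) (at s within {0..})"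
    and w: "w 0 = z0" "\<And>s. s \<ge> 0 \<Longrightarrow> w s \<in> square"
      "\<And>s. s \<ge> 0 \<Longrightarrow> (w has_vector_derivative V (w s)) (at s within {0..})"
    using assms(2,3) by (auto simp: GDA_flow_iff[OF u] V_def)
  define d where "d s = z s - w s" for s
  have d: "(d has_vector_derivative (V (z s) - V (w s))) (at s within {0..})" if "s \<ge> 0" for s
    unfolding d_def by (intro has_vector_derivative_diff z w that)
  define \<phi> where "\<phi> s = exp (- 2 * K * s) * (d s \<bullet> d s)" for s
  have D\<phi>: "(\<phi> has_real_derivative
      exp (- 2 * K * s) * (2 * (d s \<bullet> (V (z s) - V (w s))) - 2 * K * (d s \<bullet> d s))) (at s within {0..})"
    if "s \<ge> 0" for s
  proof -
    have "((\<lambda>s. d s \<bullet> d s) has_vector_derivative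
        (d s \<bullet> (V (z s) - V (w s)) + (V (z s) - V (w s)) \<bullet> d s)) (at s within {0..})"
      by (intro bounded_bilinear.has_vector_derivative[OF bounded_bilinear_inner] d that)
    then have 1: "((\<lambda>s. d s \<bullet> d s) has_real_derivative
        2 * (d s \<bullet> (V (z s) - V (w s)))) (at s within {0..})"
      by (simp add: has_real_derivative_iff_has_vector_derivative inner_commute)
    have 2: "((\<lambda>s. exp (- 2 * K * s)) has_real_derivative exp (- 2 * K * s) * (- 2 * K)) (at s within {0..})"
      by (auto intro!: derivative_eq_intros)
    show ?thesis
      unfolding \<phi>_def by (rule DERIV_cong[OF DERIV_mult[OF 2 1]]) (simp add: algebra_simps)
  qed
  have "\<phi> t \<le> \<phi> 0"
  proof (rule DERIV_nonpos_imp_decreasing_open[OF assms(4)])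
    fix s assume s: "0 < s" "s < t"
    have "(\<phi> has_real_derivative
      exp (- 2 * K * s) * (2 * (d s \<bullet> (V (z s) - V (w s))) - 2 * K * (d s \<bullet> d s))) (at s)"
      using D\<phi>[of s] s at_within_interior[of s "{0..}"] by (simp add: interior_real_atLeast)
    moreover have "d s \<bullet> (V (z s) - V (w s)) \<le> K * (d s \<bullet> d s)"
    proof -
      have "d s \<bullet> (V (z s) - V (w s)) \<le> norm (d s) * norm (V (z s) - V (w s))"
        by (rule norm_cauchy_schwarz)
      also have "\<dots> \<le> norm (d s) * (K * norm (d s))"
        unfolding d_def using s by (intro mult_left_mono V z w) auto
      finally show ?thesis by (simp add: dot_square_norm power2_eq_square algebra_simps)
    qed
    then have "exp (- 2 * K * s) * (2 * (d s \<bullet> (V (z s) - V (w s))) - 2 * K * (d s \<bullet> d s)) \<le> 0"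
      by (intro mult_nonneg_nonpos) simp_all
    ultimately show "\<exists>y. (\<phi> has_real_derivative y) (at s) \<and> y \<le> 0" by blast
  next
    have "continuous_on {0..} \<phi>"
      unfolding continuous_on_eq_continuous_within
      by (intro ballI DERIV_continuous[OF D\<phi>]) simp
    then show "continuous_on {0..t} \<phi>" by (rule continuous_on_subset) auto
  qed
  then have "d t \<bullet> d t \<le> 0"
    using z(1) w(1) by (simp add: \<phi>_def d_def mult_le_0_iff)
  then have "d t \<bullet> d t = 0" using inner_ge_zero[of "d t"] by (rule order.antisym)
  then show ?thesis by (simp add: d_def)
qed

section \<open>Periodic orbits\<close>

text \<open>The vector field on the circle of radius \<open>r\<close>, decomposed into its radial component \<open>r R\<close> and its
  angular component \<open>r \<Theta>\<close>. Only \<open>R\<close> involves \<open>q\<close>.\<close>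

lemma saddle_polar:
  fixes e q r \<theta> :: real
  defines "R \<equiv> - 2 * e * (q - swell \<theta>)"
  assumes "r\<^sup>2 > 1/5"
  shows "- dx (saddle e q) (r * cos \<theta>, r * sin \<theta>) = r * (R * cos \<theta> - turn_rate e \<theta> * sin \<theta>)"
    and "dy (saddle e q) (r * cos \<theta>, r * sin \<theta>) = r * (R * sin \<theta> + turn_rate e \<theta> * cos \<theta>)"
proof -
  have outer: "dx (saddle e q) (r * c, r * s) =
      r * (s + 2 * e * q * c - 32 * e * (c * s ^ 4 * (3 * c\<^sup>2 - s\<^sup>2)))"
    if "c\<^sup>2 + s\<^sup>2 = 1" for c s
  proof -
    have r: "r \<noteq> 0" using assms(2) by auto
    have n: "(r * c)\<^sup>2 + (r * s)\<^sup>2 = r\<^sup>2"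
      using that by (simp add: power_mult_distrib flip: distrib_left)
    have "dx ripple (r * c, r * s) = 2 * (r * c) * (r * s)\<^sup>2 * (3 * (r * c)\<^sup>2 - (r * s)\<^sup>2) / (r\<^sup>2) ^ 3"
      using dx_ripple_outer[of "r * c" "r * s"] assms(2) unfolding n by simp
    also have "2 * (r * c) * (r * s)\<^sup>2 * (3 * (r * c)\<^sup>2 - (r * s)\<^sup>2)
        = (2 * c * s\<^sup>2 * (3 * c\<^sup>2 - s\<^sup>2)) * r ^ 5"
      by algebra
    also have "\<dots> / (r\<^sup>2) ^ 3 = 2 * c * s\<^sup>2 * (3 * c\<^sup>2 - s\<^sup>2) / r"
    proof -
      have "(r\<^sup>2) ^ 3 = r * r ^ 5" by algebra
      then show ?thesis using r by simp
    qed
    finally have "(r * s)\<^sup>2 * dx ripple (r * c, r * s)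
        = (r * s)\<^sup>2 * (2 * c * s\<^sup>2 * (3 * c\<^sup>2 - s\<^sup>2) / r)" by simp
    also have "\<dots> = r * (2 * c * s ^ 4 * (3 * c\<^sup>2 - s\<^sup>2))"
      using r by (simp add: power2_eq_square power4_eq_xxxx)
    finally have eq: "(r * s)\<^sup>2 * dx ripple (r * c, r * s) = r * (2 * c * s ^ 4 * (3 * c\<^sup>2 - s\<^sup>2))" .
    show ?thesis unfolding dx_saddle eq by (simp add: algebra_simps)
  qed
  define c s where "c = cos \<theta>" and "s = sin \<theta>"
  have cs: "c\<^sup>2 + s\<^sup>2 = 1" by (simp add: c_def s_def)
  define H where "H = 16 * (c * s)\<^sup>2 * (6 * (c * s)\<^sup>2 - c ^ 4 - s ^ 4)"
  define Y where "Y = c * s * (c\<^sup>2 - s\<^sup>2) ^ 3"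
  have RT: "R = - 2 * e * (q - H)" "turn_rate e \<theta> = 1 - 32 * e * Y"
    by (simp_all add: R_def H_def Y_def swell_def turn_rate_def c_def s_def)
  \<comment> \<open>both sides become homogeneous of the same degree after the right one is multiplied by \<open>c\<^sup>2 + s\<^sup>2 = 1\<close>\<close>
  have "H * c + 16 * Y * s = 16 * (c * s ^ 4 * (3 * c\<^sup>2 - s\<^sup>2)) * (c\<^sup>2 + s\<^sup>2)"
    unfolding H_def Y_def by algebra
  then have X: "16 * (c * s ^ 4 * (3 * c\<^sup>2 - s\<^sup>2)) = H * c + 16 * Y * s" by (simp add: cs)
  have "16 * Y * c - H * s = 16 * (- s * c ^ 4 * (3 * s\<^sup>2 - c\<^sup>2)) * (c\<^sup>2 + s\<^sup>2)"
    unfolding H_def Y_def by algebra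
  then have X': "16 * (- s * c ^ 4 * (3 * (- s)\<^sup>2 - c\<^sup>2)) = 16 * Y * c - H * s" by (simp add: cs)
  have "dx (saddle e q) (r * c, r * s) = r * (s + 2 * e * q * c - 2 * e * (H * c + 16 * Y * s))"
    unfolding outer[OF cs] X[symmetric] by (simp add: algebra_simps)
  then show "- dx (saddle e q) (r * cos \<theta>, r * sin \<theta>) = r * (R * cos \<theta> - turn_rate e \<theta> * sin \<theta>)"
    by (simp add: RT algebra_simps flip: c_def s_def)
  have "dx (saddle e q) (r * - s, r * c) = r * (c + 2 * e * q * - s - 2 * e * (16 * Y * c - H * s))"
    using outer[of "- s" c] cs unfolding X'[symmetric] by (simp add: algebra_simps)
  then show "dy (saddle e q) (r * cos \<theta>, r * sin \<theta>) = r * (R * sin \<theta> + turn_rate e \<theta> * cos \<theta>)"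
    by (simp add: dy_saddle RT algebra_simps flip: c_def s_def)
qed

lemma ex_polar:
  fixes p :: "real \<times> real"
  obtains \<theta> where "p = (norm p * cos \<theta>, norm p * sin \<theta>)"
proof -
  obtain r a where p: "fst p = r * cos a" "snd p = r * sin a"
    using polar_Ex[of "fst p" "snd p"] by blast
  have "(norm p)\<^sup>2 = r\<^sup>2 * ((cos a)\<^sup>2 + (sin a)\<^sup>2)"
    by (simp add: norm_prod_def p power_mult_distrib flip: distrib_left)
  then have "(norm p)\<^sup>2 = \<bar>r\<bar>\<^sup>2" by simp
  then have n: "norm p = \<bar>r\<bar>" by (rule power2_eq_imp_eq) simp_all
  show thesis
  proof (cases "r \<ge> 0")
    case True
    then show thesis using that[of a] p n by (simp add: prod_eq_iff)
  next
    case False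
    then show thesis using that[of "a + pi"] p n by (simp add: prod_eq_iff)
  qed
qed

text \<open>The orbit is \<open>r = exp (\<sigma> (\<theta>))\<close> up to a factor that matches the starting point, traversed with the
  angular motion of \<open>ex_periodic_rotation\<close>. Since \<open>e\<close> is small, \<open>\<sigma>\<close> varies by at most \<open>1/10\<close>, so an orbit that
  starts with radius between \<open>7/10\<close> and \<open>8/10\<close> stays in the square and in the region of homogeneity.\<close>

lemma ex_periodic_GDA_flow:
  assumes e: "0 < e" "e \<le> 1 / 1000"
    and F: "\<And>\<theta>. (F has_real_derivative 1 / turn_rate e \<theta>) (at \<theta>)"
      "\<And>\<theta>. F (\<theta> + 2 * pi) = F \<theta> + T" "T > 0"
    and \<sigma>: "\<And>\<theta>. (\<sigma> has_real_derivative - 2 * e * (q - swell \<theta>) / turn_rate e \<theta>) (at \<theta>)"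
      "\<And>\<theta>. \<sigma> (\<theta> + 2 * pi) = \<sigma> \<theta>"
    and q: "0 \<le> q" "q \<le> 4"
    and z0: "7/10 < norm z0" "norm z0 < 8/10"
  obtains z where "GDA_flow (saddle e q) z0 z" "periodic_flow z"
proof -
  note \<Theta> = turn_rate_bounds[OF e]
  have \<Theta>_pos: "turn_rate e \<theta> > 0" "turn_rate e \<theta> \<le> 2" for \<theta>
    using \<Theta>[of \<theta>] by auto
  obtain \<theta>0 where \<theta>0: "z0 = (norm z0 * cos \<theta>0, norm z0 * sin \<theta>0)"
    using ex_polar by blast
  obtain \<tau> where \<tau>: "\<tau> 0 = \<theta>0" "\<And>t. (\<tau> has_real_derivative turn_rate e (\<tau> t)) (at t)"
    "\<And>t. \<tau> (t + T) = \<tau> t + 2 * pi"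
    using ex_periodic_rotation[where F = F and \<Theta> = "turn_rate e" and P = "2 * pi" and T = T
        and start = \<theta>0, OF F(1) \<Theta>_pos F(2)] by blast
  define \<rho> where "\<rho> t = norm z0 * exp (\<sigma> (\<tau> t) - \<sigma> \<theta>0)" for t
  define z where "z t = (\<rho> t * cos (\<tau> t), \<rho> t * sin (\<tau> t))" for t
  have \<sigma>_near: "\<bar>\<sigma> u - \<sigma> v\<bar> \<le> 1/10" for u v
  proof -
    have "\<bar>- 2 * e * (q - swell \<theta>) / turn_rate e \<theta>\<bar> \<le> 12 / 1000" for \<theta>
    proof -
      have "\<bar>q - swell \<theta>\<bar> \<le> 9/2"
        using q swell_bounds[of \<theta>] unfolding abs_le_iff by linarith
      then have "\<bar>- 2 * e * (q - swell \<theta>)\<bar> \<le> 2 * (1 / 1000) * (9/2)"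
        unfolding abs_mult using e by (intro mult_mono) auto
      also have "\<dots> \<le> 12 / 1000 * turn_rate e \<theta>"
        using \<Theta>(1)[of \<theta>] by simp
      finally show ?thesis
        using \<Theta>_pos(1)[of \<theta>] by (simp add: field_simps)
    qed
    from increment_of_periodic_le[OF \<sigma>(1) this _ \<sigma>(2), of u v]
    have "\<bar>\<sigma> u - \<sigma> v\<bar> \<le> 12 / 1000 * (2 * pi)" by simp
    also have "\<dots> \<le> 1/10" using pi_less_4 by simp
    finally show ?thesis .
  qed
  have \<rho>: "63/100 < \<rho> t" "\<rho> t < 9/10" for t
  proof -
    define d where "d = \<sigma> (\<tau> t) - \<sigma> \<theta>0"
    have d: "\<bar>d\<bar> \<le> 1/10" using \<sigma>_near by (simp add: d_def)
    have "9/10 \<le> exp d" using exp_ge_add_one_self[of d] d by linarith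
    then have "7/10 * (9/10) < norm z0 * exp d"
      using z0 by (intro mult_less_le_imp_less) auto
    then show "63/100 < \<rho> t" by (simp add: \<rho>_def d_def)
    have "9/10 \<le> exp (- d)" using exp_ge_add_one_self[of "- d"] d by linarith
    then have "exp d \<le> 10/9" by (simp add: exp_minus field_simps)
    then have "norm z0 * exp d \<le> 8/10 * (10/9)"
      using z0 by (intro mult_mono) auto
    then show "\<rho> t < 9/10" by (simp add: \<rho>_def d_def)
  qed
  have D\<rho>: "(\<rho> has_real_derivative \<rho> t * (- 2 * e * (q - swell (\<tau> t)))) (at t)" for t
  proof -
    have "((\<lambda>t. \<sigma> (\<tau> t)) has_real_derivative
        - 2 * e * (q - swell (\<tau> t)) / turn_rate e (\<tau> t) * turn_rate e (\<tau> t)) (at t)"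
      by (rule DERIV_chain2[OF \<sigma>(1) \<tau>(2)])
    then have "((\<lambda>t. \<sigma> (\<tau> t)) has_real_derivative - 2 * e * (q - swell (\<tau> t))) (at t)"
      using \<Theta>_pos(1)[of "\<tau> t"] by simp
    then have "((\<lambda>t. \<sigma> (\<tau> t) - \<sigma> \<theta>0) has_real_derivative - 2 * e * (q - swell (\<tau> t)) - 0) (at t)"
      by (intro DERIV_diff DERIV_const)
    from DERIV_cmult[OF DERIV_fun_exp[OF this], of "norm z0"]
    show ?thesis by (simp add: \<rho>_def[abs_def] mult.assoc)
  qed
  have Dz: "(z has_vector_derivative (- dx (saddle e q) (z t), dy (saddle e q) (z t))) (at t)" for t
  proof -
    have "(63/100)\<^sup>2 < (\<rho> t)\<^sup>2" using \<rho>(1)[of t] by (intro power_strict_mono) auto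
    then have r: "(\<rho> t)\<^sup>2 > 1/5" by (simp add: power2_eq_square)
    have "((\<lambda>t. \<rho> t * cos (\<tau> t)) has_real_derivative - dx (saddle e q) (z t)) (at t)"
      unfolding z_def saddle_polar(1)[OF r]
      by (rule DERIV_cong[OF DERIV_mult[OF D\<rho> DERIV_fun_cos[OF \<tau>(2)]]]) (simp add: algebra_simps)
    moreover have "((\<lambda>t. \<rho> t * sin (\<tau> t)) has_real_derivative dy (saddle e q) (z t)) (at t)"
      unfolding z_def saddle_polar(2)[OF r]
      by (rule DERIV_cong[OF DERIV_mult[OF D\<rho> DERIV_fun_sin[OF \<tau>(2)]]]) (simp add: algebra_simps)
    ultimately show ?thesis
      unfolding z_def[abs_def] has_real_derivative_iff_has_vector_derivative
      by (rule has_vector_derivative_Pair)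
  qed
  have "z t \<in> square" for t
  proof -
    have "\<bar>\<rho> t * cos (\<tau> t)\<bar> \<le> 1 * 1" "\<bar>\<rho> t * sin (\<tau> t)\<bar> \<le> 1 * 1"
      unfolding abs_mult using \<rho>[of t] by (intro mult_mono; simp)+
    then show ?thesis by (auto simp: z_def square_def)
  qed
  moreover have "z 0 = z0"
    using \<theta>0 by (simp add: z_def \<rho>_def \<tau>(1))
  ultimately have "GDA_flow (saddle e q) z0 z"
    using Dz by (simp add: GDA_flow_iff[OF saddle_in_smooth_funs] has_vector_derivative_at_within)
  moreover have "z (t + T) = z t" for t
    by (simp add: z_def \<rho>_def \<tau>(3) \<sigma>(2))
  then have "periodic_flow z"
    using F(3) unfolding periodic_flow_def by blast
  ultimately show thesis by (rule that)
qed

section \<open>The counterexample\<close>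

theorem theorem1p1:
  "\<exists>(f :: real \<times> real \<Rightarrow> real) (C :: real).
     smooth_square f \<and>
     critical_points f = {(0, 0)} \<and>
     (\<forall>x\<in>{-1..1}. \<forall>y\<in>{-1..1}.
        f (x, y) - (INF x'\<in>{-1..1}. f (x', y)) \<le> C * \<bar>partial_x f (x, y)\<bar>\<^sup>2 \<and>
        (SUP y'\<in>{-1..1}. f (x, y')) - f (x, y) \<le> C * \<bar>partial_y f (x, y)\<bar>\<^sup>2) \<and>
     (\<exists>U. openin (top_of_set square) U \<and> U \<noteq> {} \<and>
        (\<forall>z0\<in>U. (\<exists>z. GDA_flow f z0 z) \<and>
           (\<forall>z. GDA_flow f z0 z \<longrightarrow> periodic_flow z)))"
proof -
  obtain M1 where M1: "M1 \<ge> 1" "\<And>p. p \<in> square \<Longrightarrow> \<bar>dx ripple p\<bar> \<le> M1"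
    using smooth_funs_bounded[OF dx_ripple_in_smooth_funs] by blast
  obtain M2 where M2: "M2 \<ge> 1" "\<And>p. p \<in> square \<Longrightarrow> \<bar>dx (dx ripple) p\<bar> \<le> M2"
    using smooth_funs_bounded[OF dxx_ripple_in_smooth_funs] by blast
  define M where "M = max M1 M2"
  define e where "e = 1 / (1000 * M\<^sup>2)"
  have M: "M \<ge> 1" using M1 by (simp add: M_def)
  have e: "0 < e" "e \<le> 1 / 1000"
    using M by (simp_all add: e_def field_simps)
  obtain q F \<sigma> T where q: "1/4 \<le> q" "q \<le> 4" and T: "T > 0"
    and F: "\<And>\<theta>. (F has_real_derivative 1 / turn_rate e \<theta>) (at \<theta>)"
      "\<And>\<theta>. F (\<theta> + 2 * pi) = F \<theta> + T"
    and \<sigma>: "\<And>\<theta>. (\<sigma> has_real_derivative - 2 * e * (q - swell \<theta>) / turn_rate e \<theta>) (at \<theta>)"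
      "\<And>\<theta>. \<sigma> (\<theta> + 2 * pi) = \<sigma> \<theta>"
    using ex_balanced_swell[OF e] by metis
  interpret twisted_saddle M e q
  proof
    fix p assume p: "p \<in> square"
    show "\<bar>dx ripple p\<bar> \<le> M" "\<bar>dx (dx ripple) p\<bar> \<le> M"
      using M1(2)[OF p] M2(2)[OF p] by (auto simp: M_def)
  qed (use M q in \<open>auto simp: e_def\<close>)
  define f where "f = saddle e q"
  have f: "f \<in> smooth_funs" unfolding f_def by (rule saddle_in_smooth_funs)
  have part: "partial_x f (x, y) = dx f (x, y)" "partial_y f (x, y) = dy f (x, y)"
    if "x \<in> {-1..1}" "y \<in> {-1..1}" for x y
    using partials_eq_on_square(3,4)[OF f _ that] by blast+
  obtain C where C: "\<And>x x' y. x \<in> {-1..1} \<Longrightarrow> x' \<in> {-1..1} \<Longrightarrow> y \<in> {-1..1} \<Longrightarrow>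
      f (x, y) - f (x', y) \<le> C * (dx f (x, y))\<^sup>2"
    using saddle_PL_x unfolding f_def by blast
  have "critical_points f = {(0, 0)}"
  proof -
    have "p \<in> critical_points f \<longleftrightarrow> p = (0, 0)" for p
      using critical_point_unique[of "fst p" "snd p"] part[of "fst p" "snd p"]
      by (cases p) (auto simp: critical_points_def square_def f_def)
    then show ?thesis by blast
  qed
  moreover have "f (x, y) - (INF x'\<in>{-1..1}. f (x', y)) \<le> C * \<bar>partial_x f (x, y)\<bar>\<^sup>2 \<and>
        (SUP y'\<in>{-1..1}. f (x, y')) - f (x, y) \<le> C * \<bar>partial_y f (x, y)\<bar>\<^sup>2"
    if xy: "x \<in> {-1..1}" "y \<in> {-1..1}" for x y
  proof
    have "f (x, y) - C * (dx f (x, y))\<^sup>2 \<le> (INF x'\<in>{-1..1}. f (x', y))"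
    proof (rule cINF_greatest)
      fix x' :: real assume "x' \<in> {-1..1}"
      from C[OF xy(1) this xy(2)] show "f (x, y) - C * (dx f (x, y))\<^sup>2 \<le> f (x', y)" by simp
    qed simp
    then show "f (x, y) - (INF x'\<in>{-1..1}. f (x', y)) \<le> C * \<bar>partial_x f (x, y)\<bar>\<^sup>2"
      by (simp add: part[OF xy])
    have "(SUP y'\<in>{-1..1}. f (x, y')) \<le> f (x, y) + C * (dy f (x, y))\<^sup>2"
    proof (rule cSUP_least)
      fix y' :: real assume "y' \<in> {-1..1}"
      then show "f (x, y') \<le> f (x, y) + C * (dy f (x, y))\<^sup>2"
        using C[of "- y" "- y'" x] xy by (simp add: f_def dy_saddle saddle_quarter_turn)
    qed simp
    then show "(SUP y'\<in>{-1..1}. f (x, y')) - f (x, y) \<le> C * \<bar>partial_y f (x, y)\<bar>\<^sup>2"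
      by (simp add: part[OF xy])
  qed
  moreover have "\<exists>U. openin (top_of_set square) U \<and> U \<noteq> {} \<and>
        (\<forall>z0\<in>U. (\<exists>z. GDA_flow f z0 z) \<and> (\<forall>z. GDA_flow f z0 z \<longrightarrow> periodic_flow z))"
  proof (intro exI[of _ "square \<inter> {p. 7/10 < norm p \<and> norm p < 8/10}"] conjI ballI)
    show "openin (top_of_set square) (square \<inter> {p. 7/10 < norm p \<and> norm p < 8/10})"
      by (intro openin_open_Int open_Collect_conj open_Collect_less continuous_intros)
    have "(3/4, 0) \<in> square \<inter> {p. 7/10 < norm p \<and> norm p < 8/10}"
      by (simp add: square_def norm_Pair)
    then show "square \<inter> {p. 7/10 < norm p \<and> norm p < 8/10} \<noteq> {}" by blast
  next
    fix z0 assume "z0 \<in> square \<inter> {p. 7/10 < norm p \<and> norm p < 8/10}"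
    then obtain w where w: "GDA_flow f z0 w" "periodic_flow w"
      using ex_periodic_GDA_flow[OF e F T \<sigma>, of z0] q unfolding f_def by auto
    then show "\<exists>z. GDA_flow f z0 z" by blast
    show "\<forall>z. GDA_flow f z0 z \<longrightarrow> periodic_flow z"
    proof (intro allI impI)
      fix z assume "GDA_flow f z0 z"
      then have eq: "z t = w t" if "t \<ge> 0" for t
        using GDA_flow_unique[OF f _ w(1)] that by blast
      obtain P where "P > 0" "\<forall>t\<ge>0. w (t + P) = w t"
        using w(2) unfolding periodic_flow_def by blast
      then show "periodic_flow z"
        unfolding periodic_flow_def using eq by (intro exI[of _ P]) simp
    qed
  qed
  ultimately show ?thesis
    using smooth_funs_smooth_square[OF f] by blast
qed

end
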